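(* Let $c\in\{3,4,5\}$ and let $(X,* )$ be a finite connected quandle with profile $(\ell_1,\dots,\ell_c)$, where $1=\ell_1\leq\ell_2\leq\cdots\leq\ell_c$. Then $\ell_c$ is a multiple of $\ell_i$ for every $i\in\{1,\dots,c\}$.
   Context: A quandle is a set $X$ with a binary operation $*$ such that for all $i,j,k\in X$: (1) $i*i=i$; (2) there is a unique $x\in X$ with $x*j=i$; (3) $(i*j)*k=(i*k)*(j*k)$. For $i\in X$ the right translation is $R_i:X\to X$, $R_i(j)=j*i$; it is a permutation of $X$. A quandle is connected if the group $\langle R_i : i\in X\rangle$ acts transitively on $X$. In a finite connected quandle all right translations have the same cycle structure; the profile of the quandle is the list $(\ell_1,\dots,\ell_c)$, in nondecreasing order and with repetitions, of the lengths of all the disjoint cycles (fixed points included, as cycles of length $1$) of any right translation. Since $R_i(i)=i$, one always has $\ell_1=1$. *)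

theory Defs
  imports "HOL-Algebra.Group_Action" "HOL-Algebra.Generated_Groups"
    "HOL-Combinatorics.Orbits" "HOL-Library.Multiset"
begin

locale quandle =
  fixes X :: "'a set" and qop :: "'a \<Rightarrow> 'a \<Rightarrow> 'a" (infixl \<open>\<star>\<close> 70)
  assumes closed: "i \<in> X \<Longrightarrow> j \<in> X \<Longrightarrow> i \<star> j \<in> X"
    and idem: "i \<in> X \<Longrightarrow> i \<star> i = i"
    and right_division: "i \<in> X \<Longrightarrow> j \<in> X \<Longrightarrow> \<exists>!x. x \<in> X \<and> x \<star> j = i"
    and right_distrib:
      "i \<in> X \<Longrightarrow> j \<in> X \<Longrightarrow> k \<in> X \<Longrightarrow> (i \<star> j) \<star> k = (i \<star> k) \<star> (j \<star> k)"

text \<open>Translations are made extensional, because the elements of the library's symmetric group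
  \<^const>\<open>BijGroup\<close> are extensional functions.\<close>

definition right_translation :: "'a set \<Rightarrow> ('a \<Rightarrow> 'a \<Rightarrow> 'a) \<Rightarrow> 'a \<Rightarrow> 'a \<Rightarrow> 'a" where
  "right_translation X qop i = (\<lambda>j\<in>X. qop j i)"

definition translation_group :: "'a set \<Rightarrow> ('a \<Rightarrow> 'a \<Rightarrow> 'a) \<Rightarrow> ('a \<Rightarrow> 'a) monoid" where
  "translation_group X qop = subgroup_generated (BijGroup X) (right_translation X qop ` X)"

locale connected_quandle = quandle +
  assumes connected: "transitive_action (translation_group X qop) X (\<lambda>g. g)"

text \<open>For a permutation \<open>f\<close> of a finite set \<open>X\<close>, the sets \<open>Orbits.orbit f x\<close> with \<open>x \<in> X\<close> are the
  supports of the disjoint cycles of \<open>f\<close>, with fixed points as singletons. The multiset image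
  keeps equal lengths of different cycles apart.\<close>

definition cycle_lengths :: "'a set \<Rightarrow> ('a \<Rightarrow> 'a) \<Rightarrow> nat list" where
  "cycle_lengths X f =
     sorted_list_of_multiset (image_mset card (mset_set (Orbits.orbit f ` X)))"

text \<open>In a finite connected quandle the choice of \<open>i\<close> does not matter, see
  \<open>is_profile_iff\<close> below.\<close>

definition is_profile :: "'a set \<Rightarrow> ('a \<Rightarrow> 'a \<Rightarrow> 'a) \<Rightarrow> nat list \<Rightarrow> bool" where
  "is_profile X qop ls \<longleftrightarrow> (\<exists>i\<in>X. ls = cycle_lengths X (right_translation X qop i))"

context quandle
begin

lemma right_translation_Bij:
  assumes "i \<in> X"
  shows "right_translation X qop i \<in> Bij X"
proof -
  have "inj_on (\<lambda>j. j \<star> i) X"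
  proof (rule inj_onI)
    fix x y assume xy: "x \<in> X" "y \<in> X" "x \<star> i = y \<star> i"
    then show "x = y" using right_division[OF closed[OF xy(1) assms] assms] by auto
  qed
  moreover have "(\<lambda>j. j \<star> i) ` X = X"
  proof
    show "(\<lambda>j. j \<star> i) ` X \<subseteq> X" using closed[OF _ assms] by blast
    show "X \<subseteq> (\<lambda>j. j \<star> i) ` X" using right_division[OF _ assms] by blast
  qed
  ultimately have "bij_betw (\<lambda>j. j \<star> i) X X"
    by (simp add: bij_betw_def)
  then show ?thesis
    unfolding Bij_def right_translation_def by (simp cong: bij_betw_cong)
qed

lemma group_action_translation_group:
  "group_action (translation_group X qop) X (\<lambda>g. g)"
proof -
  interpret B: group "BijGroup X" by (rule group_BijGroup)
  have "group (translation_group X qop)"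
    unfolding translation_group_def by (rule B.group_subgroup_generated)
  moreover have "carrier (translation_group X qop) \<subseteq> carrier (BijGroup X)"
    unfolding translation_group_def by (rule B.carrier_subgroup_generated_subset)
  ultimately show ?thesis
    unfolding group_action_def group_hom_def group_hom_axioms_def hom_def
    using group_BijGroup by (auto simp: translation_group_def)
qed

end

lemma connected_quandle_iff:
  "connected_quandle X qop \<longleftrightarrow> quandle X qop \<and>
     (\<forall>x\<in>X. \<forall>y\<in>X. \<exists>g\<in>carrier (translation_group X qop). g x = y)"
  using quandle.group_action_translation_group[of X qop]
  unfolding connected_quandle_def connected_quandle_axioms_def
    transitive_action_def transitive_action_axioms_def
  by auto

lemma orbit_conj:
  assumes g: "bij_betw g X X" and f: "f ` X \<subseteq> X" and x: "x \<in> X"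
    and c: "\<And>y. y \<in> X \<Longrightarrow> f' (g y) = g (f y)"
  shows "Orbits.orbit f' (g x) = g ` Orbits.orbit f x"
proof -
  have "(f ^^ n) x \<in> X \<and> (f' ^^ n) (g x) = g ((f ^^ n) x)" for n
    using f x by (induction n) (auto simp: c)
  then show ?thesis unfolding orbit_altdef by auto
qed

lemma cycle_lengths_conj:
  assumes "finite X" and g: "bij_betw g X X" and f: "f ` X \<subseteq> X"
    and c: "\<And>y. y \<in> X \<Longrightarrow> f' (g y) = g (f y)"
  shows "cycle_lengths X f' = cycle_lengths X f"
proof -
  let ?O = "Orbits.orbit f ` X"
  have sub: "A \<subseteq> X" if A: "A \<in> ?O" for A
  proof -
    obtain x where x: "x \<in> X" "A = Orbits.orbit f x" using A by auto
    have "(f ^^ n) x \<in> X" for n using f x(1) by (induction n) auto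
    then show ?thesis unfolding x(2) orbit_altdef by auto
  qed
  have inj: "inj_on g X" and img: "g ` X = X" using g by (auto simp: bij_betw_def)
  have "Orbits.orbit f' ` X = Orbits.orbit f' ` (g ` X)" by (simp only: img)
  also have "\<dots> = (`) g ` ?O"
    unfolding image_image
    by (rule image_cong[OF refl]) (rule orbit_conj[where X = X], use g f c in auto)
  finally have eq: "Orbits.orbit f' ` X = (`) g ` ?O" .
  have "inj_on ((`) g) ?O"
  proof (rule inj_onI)
    fix A B assume "A \<in> ?O" "B \<in> ?O" "g ` A = g ` B"
    then show "A = B" using inj_on_image_eq_iff[OF inj sub sub] by blast
  qed
  then have "mset_set (Orbits.orbit f' ` X) = image_mset ((`) g) (mset_set ?O)"
    unfolding eq by (simp add: image_mset_mset_set)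
  moreover have "card (g ` A) = card A" if "A \<in> ?O" for A
    using card_image inj_on_subset[OF inj sub[OF that]] by blast
  ultimately have "image_mset card (mset_set (Orbits.orbit f' ` X)) = image_mset card (mset_set ?O)"
    using \<open>finite X\<close> by (auto simp: multiset.map_comp intro!: image_mset_cong)
  then show ?thesis unfolding cycle_lengths_def by simp
qed

lemma (in connected_quandle) cycle_lengths_right_translation:
  assumes fin: "finite X" and i: "i \<in> X" and j: "j \<in> X"
  shows "cycle_lengths X (right_translation X qop i) = cycle_lengths X (right_translation X qop j)"
proof -
  let ?R = "right_translation X qop"
  let ?G = "BijGroup X"
  have base: "h \<in> Bij X \<and> (\<forall>x\<in>X. cycle_lengths X (?R (h x)) = cycle_lengths X (?R x))"
    if "h \<in> carrier ?G \<inter> ?R ` X" for h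
  proof -
    from that obtain k where k: "k \<in> X" "h = ?R k" by auto
    have b: "?R k \<in> Bij X" using k right_translation_Bij by blast
    have "cycle_lengths X (?R (?R k x)) = cycle_lengths X (?R x)" if x: "x \<in> X" for x
    proof (rule cycle_lengths_conj[OF fin, where g = "?R k"])
      show "bij_betw (?R k) X X" using b by (simp add: Bij_def)
      show "?R x ` X \<subseteq> X" using closed x by (auto simp: right_translation_def)
      show "?R (?R k x) (?R k y) = ?R k (?R x y)" if "y \<in> X" for y
        using x k(1) that right_distrib[OF that x k(1)] by (simp add: right_translation_def closed)
    qed
    then show ?thesis unfolding k(2) using b by blast
  qed
  have inv: "g \<in> Bij X \<and> (\<forall>x\<in>X. cycle_lengths X (?R (g x)) = cycle_lengths X (?R x))"
    if "g \<in> generate ?G (carrier ?G \<inter> ?R ` X)" for g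
    using that
  proof induction
    case one
    have 1: "\<one>\<^bsub>?G\<^esub> = (\<lambda>x\<in>X. x)" by (simp add: BijGroup_def)
    show ?case unfolding 1
    proof (intro conjI ballI)
      show "(\<lambda>x\<in>X. x) \<in> Bij X" by (rule id_Bij)
    qed simp
  next
    case (incl h)
    then show ?case by (rule base)
  next
    case (inv h)
    note h = base[OF inv]
    have iv: "inv\<^bsub>?G\<^esub> h = (\<lambda>x\<in>X. inv_into X h x)" using h by (simp add: inv_BijGroup)
    have hb: "bij_betw h X X" using h by (simp add: Bij_def)
    have "cycle_lengths X (?R (inv_into X h x)) = cycle_lengths X (?R x)" if "x \<in> X" for x
    proof -
      have x: "x \<in> h ` X" using hb that by (simp add: bij_betw_def)
      have "cycle_lengths X (?R (h (inv_into X h x))) = cycle_lengths X (?R (inv_into X h x))"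
        using h inv_into_into[OF x] by blast
      then show ?thesis by (simp only: f_inv_into_f[OF x])
    qed
    then show ?case unfolding iv
      using h restrict_inv_into_Bij by (metis restrict_apply')
  next
    case (eng g h)
    then have "h \<in> X \<rightarrow> X" using Bij_imp_funcset by blast
    with eng.IH have "cycle_lengths X (?R (g (h x))) = cycle_lengths X (?R x)" if "x \<in> X" for x
      using that by (metis funcset_mem)
    with eng.IH show ?case by (simp add: BijGroup_def compose_Bij compose_eq)
  qed
  obtain g where g: "g \<in> carrier (translation_group X qop)" "g j = i"
    using transitive_action.unique_orbit[OF connected j i] by blast
  have "g \<in> generate ?G (carrier ?G \<inter> ?R ` X)"
    using g(1) by (simp add: translation_group_def subgroup_generated_def)
  then have "cycle_lengths X (?R (g j)) = cycle_lengths X (?R j)"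
    using inv j by blast
  then show ?thesis by (simp only: g(2))
qed

lemma (in connected_quandle) is_profile_iff:
  assumes "finite X"
  shows "is_profile X qop ls \<longleftrightarrow>
    X \<noteq> {} \<and> (\<forall>i\<in>X. ls = cycle_lengths X (right_translation X qop i))"
  using cycle_lengths_right_translation[OF assms] unfolding is_profile_def by blast

end

theory Submission
  imports Defs
begin

text \<open>Fix a point \<open>i\<close> and let \<open>F m i\<close> be the set of points fixed by the \<open>m\<close>-th power of the right
  translation by \<open>i\<close>, that is, the union of the cycles whose length divides \<open>m\<close>. It is a
  subquandle, because the translation is an automorphism. If \<open>m\<close> runs through the cycle lengths
  that are maximal with respect to divisibility, these subquandles cover \<open>X\<close>, and none of them
  contains another. The claim is that only one is needed; its \<open>m\<close> is then a common multiple of all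
  the lengths.

  There cannot be exactly two of them: a connected quandle is not the union of two proper
  subquandles (\<open>not_union_of_two_subquandles\<close>), just as a group is not the union of two proper
  subgroups. Hence otherwise there are at least three maximal lengths. The list contains the length \<open>1\<close> too, so at most one entry is left unknown.

  Now both the base point and the exponent matter. Automorphisms carry \<open>F m i\<close> to \<open>F m j\<close> along
  with \<open>i\<close> to \<open>j\<close>, so \<open>F m j = F m i\<close> for all \<open>j\<close> that are reached from \<open>i\<close> by translations by
  elements of \<open>F m i\<close>. With so few cycles this reaches all of \<open>F m i\<close>, so that the sets \<open>F m i\<close>
  are the classes of an equivalence relation on \<open>X\<close>. This is shown in three situations:
  \<open>class_map_fixpoints_single_cycle\<close>, \<open>class_map_fixpoints_common_divisor\<close> and
  \<open>class_map_fixpoints_pairs\<close>.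

  What remains is combinatorics. If three equivalence relations cover all pairs, every point
  has, for each relation, a partner related to it by this relation only, and the classes of their
  intersection are equally large, then all their classes have the same size
  (\<open>card_three_class_maps\<close>), as for the three subgroups of order two that cover the Klein
  four-group; but the classes of at least two of the relations here have
  different sizes. If four relations with pairwise trivial intersections cover all pairs, the
  classes have at most three elements (\<open>card_four_class_maps\<close>), which leaves no room for two
  different lengths greater than \<open>1\<close>.\<close>

section \<open>Covering a set by equivalence relations\<close>

text \<open>An equivalence relation on \<open>X\<close> is given by the function that sends each point to its
  class, because this is the form in which the sets of fixed points arise.\<close>

definition class_map :: "'a set \<Rightarrow> ('a \<Rightarrow> 'a set) \<Rightarrow> bool" where
  "class_map X A \<longleftrightarrow> (\<forall>x\<in>X. A x \<subseteq> X \<and> x \<in> A x \<and> (\<forall>y\<in>A x. A y = A x))"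

lemma class_map_eq: "class_map X A \<Longrightarrow> x \<in> X \<Longrightarrow> y \<in> A x \<Longrightarrow> A y = A x"
  unfolding class_map_def by blast

lemma class_map_self: "class_map X A \<Longrightarrow> x \<in> X \<Longrightarrow> x \<in> A x"
  unfolding class_map_def by blast

lemma class_map_subset: "class_map X A \<Longrightarrow> x \<in> X \<Longrightarrow> A x \<subseteq> X"
  unfolding class_map_def by blast

text \<open>A point \<open>w\<close> related to \<open>x\<close> by the third relation only is also related only
  by the third relation to a common relative \<open>y\<close> of \<open>x\<close> under the first two. So \<open>w\<close> links \<open>x\<close>
  and \<open>y\<close> in the third relation.\<close>

lemma three_class_maps_Int:
  assumes cm: "class_map X A" "class_map X B" "class_map X D"
    and cover: "\<And>x. x \<in> X \<Longrightarrow> A x \<union> B x \<union> D x = X"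
    and x: "x \<in> X" and w: "w \<in> X" "w \<notin> A x" "w \<notin> B x"
  shows "A x \<inter> B x \<subseteq> D x"
proof
  fix y assume y: "y \<in> A x \<inter> B x"
  then have yX: "y \<in> X" using class_map_subset[OF cm(1) x] by blast
  have "A y = A x" "B y = B x" using class_map_eq[OF cm(1) x] class_map_eq[OF cm(2) x] y by auto
  then have "w \<in> D y" using cover[OF yX] w by blast
  then have "D w = D y" by (rule class_map_eq[OF cm(3) yX])
  moreover have "w \<in> D x" using cover[OF x] w by blast
  then have "D w = D x" by (rule class_map_eq[OF cm(3) x])
  ultimately show "y \<in> D x" using class_map_self[OF cm(3) yX] by simp
qed

text \<open>By the previous lemma every two of the relations meet in the intersection \<open>E\<close>
  of all three. Points that are related to \<open>x\<close> only by \<open>A\<close> must be related to \<open>v\<close>, which is related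
  to \<open>x\<close> only by \<open>B\<close>, through \<open>D\<close>, and to \<open>w\<close>, which is related to \<open>x\<close> only by \<open>D\<close>, through \<open>B\<close>.
  Hence they are \<open>E\<close>-related to each other, and the class \<open>A x\<close> consists of just two classes of
  \<open>E\<close>.\<close>

lemma card_three_class_maps:
  assumes fin: "finite X"
    and cm: "class_map X A" "class_map X B" "class_map X D"
    and cover: "\<And>x. x \<in> X \<Longrightarrow> A x \<union> B x \<union> D x = X"
    and priv: "\<And>x. x \<in> X \<Longrightarrow> A x - (B x \<union> D x) \<noteq> {}"
      "\<And>x. x \<in> X \<Longrightarrow> B x - (A x \<union> D x) \<noteq> {}"
      "\<And>x. x \<in> X \<Longrightarrow> D x - (A x \<union> B x) \<noteq> {}"
    and f: "\<And>x. x \<in> X \<Longrightarrow> card (A x \<inter> B x \<inter> D x) = f"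
    and x: "x \<in> X"
  shows "card (A x) = 2 * f"
proof -
  obtain u v w where u: "u \<in> A x" "u \<notin> B x" "u \<notin> D x" and v: "v \<in> B x" "v \<notin> A x" "v \<notin> D x"
    and w: "w \<in> D x" "w \<notin> A x" "w \<notin> B x"
    using priv[OF x] by blast
  have X: "u \<in> X" "v \<in> X" "w \<in> X"
    using class_map_subset[OF cm(1) x] class_map_subset[OF cm(2) x] class_map_subset[OF cm(3) x]
      u v w by auto
  have AD: "A x \<inter> D x \<subseteq> B x"
    by (rule three_class_maps_Int[OF cm(1,3,2) _ x X(2) v(2,3)]) (use cover in blast)
  have AB: "A x \<inter> B x \<subseteq> D x"
    by (rule three_class_maps_Int[OF cm _ x X(3) w(2,3)]) (use cover in blast)
  have D: "D y = D v" "B y = B w" if y: "y \<in> A x" "y \<notin> B x \<inter> D x" for y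
  proof -
    have yX: "y \<in> X" using y class_map_subset[OF cm(1) x] by blast
    have y': "y \<notin> B x" "y \<notin> D x" using AB AD y by blast+
    have Ay: "A y = A x" using class_map_eq[OF cm(1) x y(1)] .
    have By: "B y \<noteq> B x" "D y \<noteq> D x"
      using y' class_map_self[OF cm(2) yX] class_map_self[OF cm(3) yX] by auto
    have "v \<notin> B y" using class_map_eq[OF cm(2) yX] class_map_eq[OF cm(2) x v(1)] By by metis
    then have "v \<in> D y" using cover[OF yX] X v Ay by blast
    then show "D y = D v" using class_map_eq[OF cm(3) yX] by blast
    have "w \<notin> D y" using class_map_eq[OF cm(3) yX] class_map_eq[OF cm(3) x w(1)] By by metis
    then have "w \<in> B y" using cover[OF yX] X w Ay by blast
    then show "B y = B w" using class_map_eq[OF cm(2) yX] by blast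
  qed
  let ?E = "\<lambda>x. A x \<inter> B x \<inter> D x"
  have Au: "A u = A x" using class_map_eq[OF cm(1) x u(1)] .
  have "A x = ?E x \<union> ?E u"
  proof
    show "?E x \<union> ?E u \<subseteq> A x" using Au by blast
    show "A x \<subseteq> ?E x \<union> ?E u"
    proof
      fix y assume y: "y \<in> A x"
      show "y \<in> ?E x \<union> ?E u"
      proof (cases "y \<in> B x \<inter> D x")
        case False
        then have "D y = D u" "B y = B u" using D[OF y] D[OF u(1)] u by auto
        moreover have "y \<in> B y" "y \<in> D y"
          using class_map_self[OF cm(2)] class_map_self[OF cm(3)] y class_map_subset[OF cm(1) x] by auto
        ultimately show ?thesis using y Au by blast
      qed (use y in blast)
    qed
  qed
  moreover have "?E x \<inter> ?E u = {}"
  proof (rule ccontr)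
    assume "?E x \<inter> ?E u \<noteq> {}"
    then obtain y where y: "y \<in> B x" "y \<in> B u" by blast
    have "B u = B x" using class_map_eq[OF cm(2) x y(1)] class_map_eq[OF cm(2) X(1) y(2)] by simp
    then show False using class_map_self[OF cm(2) X(1)] u by simp
  qed
  moreover have "finite (?E x)" "finite (?E u)"
    using finite_subset[OF class_map_subset[OF cm(1)] fin] x X by auto
  ultimately have "card (A x) = card (?E x) + card (?E u)"
    using card_Un_disjoint[of "?E x" "?E u"] by simp
  then show ?thesis using f[OF x] f[OF X(1)] by simp
qed

text \<open>Take \<open>b\<close> related to \<open>x\<close> by \<open>B\<close>. A point of \<open>A x\<close> other than \<open>x\<close> can only be
  related to \<open>b\<close> by \<open>C\<close> or by \<open>D\<close>, and each of these happens for at most one point, because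
  two such points would be related both by \<open>A\<close> and by \<open>C\<close> (or \<open>D\<close>).\<close>

lemma card_four_class_maps:
  assumes fin: "finite X"
    and cm: "class_map X A" "class_map X B" "class_map X C" "class_map X D"
    and cover: "\<And>x. x \<in> X \<Longrightarrow> A x \<union> B x \<union> C x \<union> D x = X"
    and triv: "\<And>x. x \<in> X \<Longrightarrow> A x \<inter> B x = {x}" "\<And>x. x \<in> X \<Longrightarrow> A x \<inter> C x = {x}"
      "\<And>x. x \<in> X \<Longrightarrow> A x \<inter> D x = {x}"
    and x: "x \<in> X" and ntriv: "B x \<noteq> {x}"
  shows "card (A x) \<le> 3"
proof -
  obtain b where b: "b \<in> B x" "b \<noteq> x" using ntriv class_map_self[OF cm(2) x] by blast
  have bX: "b \<in> X" using b class_map_subset[OF cm(2) x] by blast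
  have AX: "A x \<subseteq> X" using class_map_subset[OF cm(1) x] .
  have meets_once: "card (A x \<inter> G b) \<le> 1"
    if G: "class_map X G" and AG: "\<And>x. x \<in> X \<Longrightarrow> A x \<inter> G x = {x}" for G
  proof -
    have "u = v" if uv: "u \<in> A x \<inter> G b" "v \<in> A x \<inter> G b" for u v
    proof -
      have "A u = A x" "G u = G b" using class_map_eq[OF cm(1) x] class_map_eq[OF G bX] uv by auto
      then have "v \<in> A u \<inter> G u" using uv by simp
      moreover have "u \<in> X" using uv AX by blast
      ultimately show ?thesis using AG by auto
    qed
    then show ?thesis using finite_subset[OF AX fin] card_le_Suc0_iff_eq[of "A x \<inter> G b"]
      by auto
  qed
  have "A x \<subseteq> insert x ((A x \<inter> C b) \<union> (A x \<inter> D b))"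
  proof
    fix u assume u: "u \<in> A x"
    have uX: "u \<in> X" using u AX by blast
    show "u \<in> insert x ((A x \<inter> C b) \<union> (A x \<inter> D b))"
    proof (cases "u = x")
      case False
      have "u \<notin> A b"
      proof
        assume "u \<in> A b"
        then have "A b = A x" using class_map_eq[OF cm(1) bX] class_map_eq[OF cm(1) x u] by blast
        then show False using class_map_self[OF cm(1) bX] triv(1)[OF x] b by blast
      qed
      moreover have "u \<notin> B b"
        using class_map_eq[OF cm(2) x b(1)] triv(1)[OF x] u False by blast
      ultimately show ?thesis using cover[OF bX] uX u by blast
    qed blast
  qed
  then have "card (A x) \<le> card (insert x ((A x \<inter> C b) \<union> (A x \<inter> D b)))"
    using AX fin by (intro card_mono) (auto intro: finite_subset)
  also have "\<dots> \<le> Suc (card (A x \<inter> C b) + card (A x \<inter> D b))"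
    by (rule order_trans[OF card_insert_le_m1[of "Suc (card (A x \<inter> C b) + card (A x \<inter> D b))"]])
      (auto intro: card_Un_le)
  also have "\<dots> \<le> 3" using meets_once[OF cm(3) triv(2)] meets_once[OF cm(4) triv(3)] by simp
  finally show ?thesis .
qed

section \<open>Maximal elements with respect to divisibility\<close>

definition dvd_antichain :: "nat set \<Rightarrow> bool" where
  "dvd_antichain S \<longleftrightarrow> (\<forall>u\<in>S. \<forall>v\<in>S. u dvd v \<longrightarrow> u = v)"

lemma dvd_antichain_three:
  assumes "dvd_antichain {p, q, r}" "distinct [p, q, r]"
  shows "\<not> p dvd q" "\<not> p dvd r" "\<not> q dvd p" "\<not> q dvd r" "\<not> r dvd p" "\<not> r dvd q"
  using assms unfolding dvd_antichain_def by auto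

lemma finite_dvd_maximal:
  fixes S :: "nat set"
  assumes "finite S" "0 \<notin> S" "n \<in> S"
  shows "\<exists>m\<in>S. n dvd m \<and> (\<forall>k\<in>S. m dvd k \<longrightarrow> k = m)"
proof -
  let ?D = "{m \<in> S. n dvd m}"
  have D: "finite ?D" "?D \<noteq> {}" using assms by auto
  have "k = Max ?D" if k: "k \<in> S" "Max ?D dvd k" for k
  proof -
    have "k \<in> ?D" using k Max_in[OF D] by (auto intro: dvd_trans)
    then have "k \<le> Max ?D" using D by simp
    moreover have "Max ?D \<le> k" using k assms(2) by (intro dvd_imp_le) (auto intro: gr0I)
    ultimately show ?thesis by simp
  qed
  then show ?thesis using Max_in[OF D] by blast
qed

section \<open>Cycles of translations\<close>

lemma funpow_fixes_iff_card_orbit_dvd: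
  assumes "permutation f"
  shows "(f ^^ m) x = x \<longleftrightarrow> card (Orbits.orbit f x) dvd m"
proof -
  let ?d = "funpow_dist1 f x x"
  have x: "x \<in> Orbits.orbit f x" using permutation_self_in_orbit[OF assms] .
  have d: "card (Orbits.orbit f x) = ?d"
    using orbit_conv_funpow_dist1[OF x] inj_on_funpow_dist1[OF x] by (simp add: card_image)
  have fix_d: "(f ^^ ?d) x = x" using funpow_dist1_prop[OF x] .
  have "(f ^^ m) x = (f ^^ (m mod ?d)) x" using funpow_mod_eq[OF fix_d] by simp
  moreover have "(f ^^ (m mod ?d)) x \<noteq> x" if "m mod ?d \<noteq> 0"
    using funpow_dist1_least[of "m mod ?d" f x x] that by simp
  ultimately have "(f ^^ m) x = x \<longleftrightarrow> m mod ?d = 0" by (metis funpow_0)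
  then show ?thesis unfolding d by (simp add: dvd_eq_mod_eq_0)
qed

locale finite_connected_quandle = connected_quandle +
  assumes finite_X: "finite X"
begin

text \<open>The translations are extended by the identity rather than by the undefined value, which
  makes them permutations of the whole type.\<close>

definition tr :: "'a \<Rightarrow> 'a \<Rightarrow> 'a" where
  "tr i x = (if x \<in> X then x \<star> i else x)"

definition len :: "'a \<Rightarrow> 'a \<Rightarrow> nat" where
  "len i x = card (Orbits.orbit (tr i) x)"

definition fixpoints :: "nat \<Rightarrow> 'a \<Rightarrow> 'a set" where
  "fixpoints m i = {x \<in> X. (tr i ^^ m) x = x}"

lemma cancel: "x \<in> X \<Longrightarrow> y \<in> X \<Longrightarrow> i \<in> X \<Longrightarrow> x \<star> i = y \<star> i \<Longrightarrow> x = y"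
  using right_division[OF closed[of x i], of i] by auto

lemma tr_permutes: "i \<in> X \<Longrightarrow> tr i permutes X"
proof -
  assume i: "i \<in> X"
  have "right_translation X qop i \<in> Bij X" using right_translation_Bij[OF i] .
  then have "bij_betw (right_translation X qop i) X X" by (simp add: Bij_def)
  then have "bij_betw (tr i) X X"
    by (rule bij_betw_cong[THEN iffD1, rotated]) (simp add: tr_def right_translation_def)
  then show ?thesis by (rule bij_imp_permutes) (simp add: tr_def)
qed

lemma tr_permutation: "i \<in> X \<Longrightarrow> permutation (tr i)"
  using tr_permutes finite_X by (auto simp: permutation_permutes)

lemma funpow_tr_closed: "i \<in> X \<Longrightarrow> x \<in> X \<Longrightarrow> (tr i ^^ n) x \<in> X"
  by (induction n) (auto simp: tr_def closed)

lemma orbit_tr: "i \<in> X \<Longrightarrow> x \<in> X \<Longrightarrow> Orbits.orbit (tr i) x = {(tr i ^^ n) x | n. True}"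
  using orbit_altdef_permutation[OF tr_permutation] by blast

lemma orbit_tr_subset: "i \<in> X \<Longrightarrow> x \<in> X \<Longrightarrow> Orbits.orbit (tr i) x \<subseteq> X"
  using orbit_tr funpow_tr_closed by auto

lemma self_in_orbit_tr: "i \<in> X \<Longrightarrow> x \<in> Orbits.orbit (tr i) x"
  using permutation_self_in_orbit[OF tr_permutation] by blast

lemma orbit_tr_eq: "i \<in> X \<Longrightarrow> y \<in> Orbits.orbit (tr i) x \<Longrightarrow> Orbits.orbit (tr i) y = Orbits.orbit (tr i) x"
  by (rule orbit_cyclic_eq3) (auto intro: cyclic_on_orbit' tr_permutation)

lemma len_pos: "i \<in> X \<Longrightarrow> x \<in> X \<Longrightarrow> 0 < len i x"
  unfolding len_def using self_in_orbit_tr orbit_tr_subset finite_X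
  by (metis card_gt_0_iff empty_iff finite_subset)

lemma len_orbit: "i \<in> X \<Longrightarrow> y \<in> Orbits.orbit (tr i) x \<Longrightarrow> len i y = len i x"
  unfolding len_def using orbit_tr_eq by simp

lemma fixpoints_iff: "i \<in> X \<Longrightarrow> x \<in> fixpoints m i \<longleftrightarrow> x \<in> X \<and> len i x dvd m"
  unfolding fixpoints_def len_def using funpow_fixes_iff_card_orbit_dvd[OF tr_permutation] by auto

lemma fixpoints_subset: "fixpoints m i \<subseteq> X"
  unfolding fixpoints_def by blast

lemma finite_fixpoints: "finite (fixpoints m i)"
  using finite_subset[OF fixpoints_subset finite_X] .

lemma dvd_card_if_dvd_len:
  assumes "i \<in> X" "S \<subseteq> X" "\<And>s. s \<in> S \<Longrightarrow> s \<star> i \<in> S" "\<And>s. s \<in> S \<Longrightarrow> e dvd len i s"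
  shows "e dvd card S"
proof -
  have sub: "Orbits.orbit (tr i) s \<subseteq> S" if "s \<in> S" for s
  proof -
    have "(tr i ^^ n) s \<in> S" for n
      using that assms(2,3) by (induction n) (auto simp: tr_def)
    moreover have "s \<in> X" using that assms(2) by blast
    ultimately show ?thesis using orbit_tr[OF assms(1), of s] by auto
  qed
  have "S = \<Union> (Orbits.orbit (tr i) ` S)"
    using sub self_in_orbit_tr[OF assms(1)] by blast
  moreover have "e dvd card (\<Union> (Orbits.orbit (tr i) ` S))"
  proof (rule dvd_partition)
    show "finite (\<Union> (Orbits.orbit (tr i) ` S))"
      using calculation finite_subset[OF assms(2) finite_X] by simp
    show "\<forall>c\<in>Orbits.orbit (tr i) ` S. e dvd card c" using assms(4) by (auto simp: len_def)
    show "\<forall>c1\<in>Orbits.orbit (tr i) ` S. \<forall>c2\<in>Orbits.orbit (tr i) ` S. c1 \<noteq> c2 \<longrightarrow> c1 \<inter> c2 = {}"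
      using orbit_tr_eq[OF assms(1)] by blast
  qed
  ultimately show ?thesis by simp
qed

text \<open>The two extensions of a translation have the same orbits on \<open>X\<close>, so the
  profile can be read off from \<open>tr\<close>.\<close>

lemma mset_cycle_lengths:
  assumes i: "i \<in> X"
  shows "mset (cycle_lengths X (right_translation X qop i)) =
    image_mset card (mset_set (Orbits.orbit (tr i) ` X))"
proof -
  have "Orbits.orbit (right_translation X qop i) x = Orbits.orbit (tr i) x" if x: "x \<in> X" for x
  proof -
    have "(right_translation X qop i ^^ n) x = (tr i ^^ n) x" for n
    proof (induction n)
      case (Suc n)
      then show ?case using funpow_tr_closed[OF i x, of n]
        by (simp add: tr_def[of _ "(tr i ^^ n) x"] right_translation_def)
    qed simp
    then show ?thesis unfolding orbit_altdef by simp
  qed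
  then have "Orbits.orbit (right_translation X qop i) ` X = Orbits.orbit (tr i) ` X"
    by (rule image_cong[OF refl])
  then show ?thesis unfolding cycle_lengths_def by simp
qed

lemma set_cycle_lengths:
  assumes i: "i \<in> X"
  shows "set (cycle_lengths X (right_translation X qop i)) = len i ` X"
proof -
  have "set (cycle_lengths X (right_translation X qop i)) = card ` Orbits.orbit (tr i) ` X"
    unfolding set_mset_mset[symmetric] mset_cycle_lengths[OF i] using finite_X by simp
  then show ?thesis by (auto simp: len_def)
qed

lemma card_len_eq_sum:
  assumes i: "i \<in> X" and l: "l = cycle_lengths X (right_translation X qop i)"
  shows "card {x \<in> X. P (len i x)} = sum_mset (filter_mset P (mset l))"
proof -
  let ?O = "Orbits.orbit (tr i) ` X"
  have U: "{x \<in> X. P (len i x)} = \<Union> {S \<in> ?O. P (card S)}"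
  proof
    show "{x \<in> X. P (len i x)} \<subseteq> \<Union> {S \<in> ?O. P (card S)}"
      using self_in_orbit_tr[OF i] by (auto simp: len_def)
    show "\<Union> {S \<in> ?O. P (card S)} \<subseteq> {x \<in> X. P (len i x)}"
    proof
      fix y assume "y \<in> \<Union> {S \<in> ?O. P (card S)}"
      then obtain x where x: "x \<in> X" "y \<in> Orbits.orbit (tr i) x" "P (len i x)"
        by (auto simp: len_def)
      then show "y \<in> {x \<in> X. P (len i x)}"
        using len_orbit[OF i x(2)] orbit_tr_subset[OF i x(1)] by auto
    qed
  qed
  have "card (\<Union> {S \<in> ?O. P (card S)}) = (\<Sum>S \<in> {S \<in> ?O. P (card S)}. card S)"
  proof (rule card_Union_disjoint)
    show "disjoint {S \<in> ?O. P (card S)}"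
      using orbit_tr_eq[OF i] unfolding pairwise_def disjnt_def by blast
    show "finite A" if "A \<in> {S \<in> ?O. P (card S)}" for A
      using that orbit_tr_subset[OF i] finite_X by (auto intro: finite_subset)
  qed
  also have "\<dots> = sum_mset (image_mset card (filter_mset (\<lambda>S. P (card S)) (mset_set ?O)))"
    using finite_X by (simp add: sum_unfold_sum_mset filter_mset_mset_set)
  also have "\<dots> = sum_mset (filter_mset P (mset l))"
    unfolding l mset_cycle_lengths[OF i] by (simp add: filter_mset_image_mset)
  finally show ?thesis unfolding U .
qed

section \<open>Connectedness\<close>

text \<open>The form in which connectedness is used below. By finiteness, a set closed under
  the translations is mapped onto itself by them, hence by the group that they generate.\<close>

lemma connected_closed_eq:
  assumes S: "S \<subseteq> X" "S \<noteq> {}" and cl: "\<And>s k. s \<in> S \<Longrightarrow> k \<in> X \<Longrightarrow> s \<star> k \<in> S"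
  shows "S = X"
proof -
  let ?R = "right_translation X qop"
  let ?G = "BijGroup X"
  have fin: "finite S" using finite_subset[OF S(1) finite_X] .
  have base: "h \<in> Bij X \<and> h ` S = S" if h: "h \<in> carrier ?G \<inter> ?R ` X" for h
  proof -
    obtain k where k: "k \<in> X" "h = ?R k" using h by auto
    have b: "h \<in> Bij X" using k right_translation_Bij by blast
    then have "inj_on h S" using S(1) by (auto simp: Bij_def bij_betw_def intro: inj_on_subset)
    moreover have "h ` S \<subseteq> S" using cl k S(1) by (auto simp: right_translation_def)
    ultimately have "h ` S = S" using endo_inj_surj[OF fin] by blast
    with b show ?thesis by blast
  qed
  have gen: "g \<in> Bij X \<and> g ` S = S" if "g \<in> generate ?G (carrier ?G \<inter> ?R ` X)" for g
    using that
  proof induction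
    case one
    have 1: "\<one>\<^bsub>?G\<^esub> = (\<lambda>x\<in>X. x)" by (simp add: BijGroup_def)
    have 2: "(\<lambda>x\<in>X. x) ` S = S" using S(1) by auto
    show ?case unfolding 1 using id_Bij 2 by (rule conjI)
  next
    case (incl h)
    then show ?case by (rule base)
  next
    case (inv h)
    have h: "h \<in> Bij X" "h ` S = S" using base[OF inv] by auto
    have iv: "inv\<^bsub>?G\<^esub> h = (\<lambda>x\<in>X. inv_into X h x)" using h by (simp add: inv_BijGroup)
    have "inj_on h X" using h by (simp add: Bij_def bij_betw_def)
    then have "inv_into X h ` h ` S = S" using S(1) by (rule inv_into_image_cancel)
    then have "inv_into X h ` S = S" unfolding h(2) .
    moreover have "(\<lambda>x\<in>X. inv_into X h x) ` S = inv_into X h ` S"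
      using S(1) by (intro image_cong) auto
    ultimately have "(\<lambda>x\<in>X. inv_into X h x) ` S = S" by simp
    then show ?case unfolding iv using h(1) restrict_inv_into_Bij by blast
  next
    case (eng g h)
    have "g \<otimes>\<^bsub>?G\<^esub> h = compose X g h" using eng.IH by (simp add: BijGroup_def)
    moreover have "compose X g h ` S = g ` h ` S"
      unfolding image_image using S(1) by (intro image_cong) (auto simp: compose_eq)
    ultimately show ?case using eng.IH by (simp add: compose_Bij)
  qed
  show ?thesis
  proof
    show "X \<subseteq> S"
    proof
      fix y assume y: "y \<in> X"
      obtain s where s: "s \<in> S" using S(2) by blast
      obtain g where g: "g \<in> carrier (translation_group X qop)" "g s = y"
        using transitive_action.unique_orbit[OF connected, of s y] s S(1) y by blast
      have "g \<in> generate ?G (carrier ?G \<inter> ?R ` X)"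
        using g(1) by (simp add: translation_group_def subgroup_generated_def)
      then show "y \<in> S" using gen g(2) s by blast
    qed
  qed (rule S(1))
qed

lemma in_if_translate_in:
  assumes "S \<subseteq> X" "\<And>s. s \<in> S \<Longrightarrow> s \<star> k \<in> S" "k \<in> X" "x \<in> X" "x \<star> k \<in> S"
  shows "x \<in> S"
proof -
  have "inj_on (\<lambda>s. s \<star> k) S" using cancel assms(1,3) by (auto intro!: inj_onI)
  moreover have "(\<lambda>s. s \<star> k) ` S \<subseteq> S" using assms(2) by blast
  ultimately have "(\<lambda>s. s \<star> k) ` S = S"
    using endo_inj_surj[OF finite_subset[OF assms(1) finite_X]] by blast
  then obtain s where "s \<in> S" "x \<star> k = s \<star> k" using assms(5) by blast
  then show ?thesis using cancel[of x s k] assms by blast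
qed

text \<open>Suppose that \<open>A\<close> and \<open>B\<close> are proper. Translations by elements of \<open>B - A\<close>
  preserve \<open>A - B\<close>, and translations by elements of \<open>A\<close> preserve \<open>B - A\<close>. Therefore the subgroup
  generated by the translations by elements of \<open>B - A\<close> is normalised by all translations, and as
  these are all conjugate, it contains them all. But then all translations preserve \<open>A - B\<close>,
  contrary to connectedness.

  In the proof the subgroup is represented by the collection \<open>P\<close> of the sets that it preserves. The
  set \<open>Z\<close> collects the points whose translation preserves every member of \<open>P\<close>; normality makes
  \<open>P\<close> invariant under all translations, and \<open>Z\<close> closed under them.\<close>

lemma not_union_of_two_subquandles:
  assumes AB: "A \<union> B = X"
    and A: "\<And>x y. x \<in> A \<Longrightarrow> y \<in> A \<Longrightarrow> x \<star> y \<in> A"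
    and B: "\<And>x y. x \<in> B \<Longrightarrow> y \<in> B \<Longrightarrow> x \<star> y \<in> B"
  shows "A = X \<or> B = X"
proof (rule ccontr)
  assume "\<not> (A = X \<or> B = X)"
  then have ne: "A - B \<noteq> {}" "B - A \<noteq> {}" "A - B \<noteq> X" using AB by blast+
  have AX: "A \<subseteq> X" and BX: "B \<subseteq> X" using AB by blast+
  have BA: "x \<star> k \<in> B - A" if "x \<in> B - A" "k \<in> A" for x k
    using in_if_translate_in[OF AX A] that AB closed by blast
  have AB': "x \<star> k \<in> A - B" if "x \<in> A - B" "k \<in> B" for x k
    using in_if_translate_in[OF BX B] that AB closed by blast
  define P where "P = {S. S \<subseteq> X \<and> (\<forall>s\<in>S. \<forall>y\<in>B - A. s \<star> y \<in> S)}"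
  have preimage: "{x \<in> X. x \<star> k \<in> S} \<in> P" if S: "S \<in> P" and k: "k \<in> X" for S k
  proof (cases "k \<in> A")
    case True
    have "(x \<star> y) \<star> k \<in> S" if "x \<in> X" "x \<star> k \<in> S" "y \<in> B - A" for x y
    proof -
      have "(x \<star> y) \<star> k = (x \<star> k) \<star> (y \<star> k)" using right_distrib that k BX by blast
      then show ?thesis using S that BA[OF that(3) True] unfolding P_def by auto
    qed
    then show ?thesis unfolding P_def using closed BX by auto
  next
    case False
    then have "k \<in> B - A" using k AB by blast
    then have "{x \<in> X. x \<star> k \<in> S} = S"
      using in_if_translate_in[of S k] S k unfolding P_def by blast
    then show ?thesis using S by simp
  qed
  define Z where "Z = {x \<in> X. \<forall>S\<in>P. \<forall>s\<in>S. s \<star> x \<in> S}"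
  have "Z = X"
  proof (rule connected_closed_eq)
    show "Z \<subseteq> X" unfolding Z_def by blast
    show "Z \<noteq> {}" using ne(2) BX unfolding Z_def P_def by blast
    fix x k assume x: "x \<in> Z" and k: "k \<in> X"
    have xX: "x \<in> X" and xZ: "\<And>S s. S \<in> P \<Longrightarrow> s \<in> S \<Longrightarrow> s \<star> x \<in> S"
      using x by (simp_all add: Z_def)
    have "s \<star> (x \<star> k) \<in> S" if S: "S \<in> P" "s \<in> S" for S s
    proof -
      have "s \<in> X" using S unfolding P_def by blast
      then obtain t where t: "t \<in> X" "t \<star> k = s" using right_division[OF _ k] by blast
      have "t \<star> x \<in> {x \<in> X. x \<star> k \<in> S}"
        by (rule xZ[OF preimage[OF S(1) k]]) (use S(2) t in simp)
      moreover have "(t \<star> x) \<star> k = s \<star> (x \<star> k)" using right_distrib[OF t(1) xX k] t(2) by simp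
      ultimately show ?thesis by simp
    qed
    then show "x \<star> k \<in> Z" using closed[OF xX k] by (simp add: Z_def)
  qed
  moreover have "A - B \<in> P" using AB' AX unfolding P_def by blast
  ultimately have "s \<star> x \<in> A - B" if "s \<in> A - B" "x \<in> X" for s x
    using that unfolding Z_def by blast
  then have "A - B = X" using AX ne(1) by (intro connected_closed_eq) auto
  then show False using ne(3) by blast
qed


section \<open>Points fixed by a power of a translation\<close>

lemma tr_apply: "x \<in> X \<Longrightarrow> tr i x = x \<star> i"
  by (simp add: tr_def)

lemma funpow_tr_translate:
  "i \<in> X \<Longrightarrow> k \<in> X \<Longrightarrow> x \<in> X \<Longrightarrow> (tr (i \<star> k) ^^ n) (x \<star> k) = (tr i ^^ n) x \<star> k"
proof (induction n)
  case (Suc n)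
  have "(tr i ^^ n) x \<in> X" using Suc.prems funpow_tr_closed by blast
  then show ?case using Suc right_distrib[of "(tr i ^^ n) x" i k] by (simp add: tr_apply closed)
qed simp

lemma funpow_tr_hom:
  "i \<in> X \<Longrightarrow> x \<in> X \<Longrightarrow> y \<in> X \<Longrightarrow> (tr i ^^ n) (x \<star> y) = (tr i ^^ n) x \<star> (tr i ^^ n) y"
proof (induction n)
  case (Suc n)
  have "(tr i ^^ n) x \<in> X" "(tr i ^^ n) y \<in> X" using Suc.prems funpow_tr_closed by blast+
  then show ?case using Suc right_distrib[of "(tr i ^^ n) x" "(tr i ^^ n) y" i]
    by (simp add: tr_apply closed)
qed simp

lemma len_self: "i \<in> X \<Longrightarrow> len i i = 1"
proof -
  assume i: "i \<in> X"
  then have "tr i i = i" using idem by (simp add: tr_def)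
  then have "Orbits.orbit (tr i) i = {i}" by (simp only: orbit_eq_singleton_iff)
  then show ?thesis by (simp add: len_def)
qed

lemma self_in_fixpoints: "i \<in> X \<Longrightarrow> i \<in> fixpoints m i"
  using fixpoints_iff len_self by simp

lemma fixpoints_closed: "i \<in> X \<Longrightarrow> x \<in> fixpoints m i \<Longrightarrow> y \<in> fixpoints m i \<Longrightarrow> x \<star> y \<in> fixpoints m i"
  unfolding fixpoints_def using funpow_tr_hom closed by auto

lemma fixpoints_translate:
  assumes i: "i \<in> X" and k: "k \<in> X"
  shows "fixpoints m (i \<star> k) = (\<lambda>x. x \<star> k) ` fixpoints m i"
proof
  show "(\<lambda>x. x \<star> k) ` fixpoints m i \<subseteq> fixpoints m (i \<star> k)"
    using funpow_tr_translate[OF i k] closed k unfolding fixpoints_def by auto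
  show "fixpoints m (i \<star> k) \<subseteq> (\<lambda>x. x \<star> k) ` fixpoints m i"
  proof
    fix y assume y: "y \<in> fixpoints m (i \<star> k)"
    then obtain x where x: "x \<in> X" "x \<star> k = y"
      using right_division[OF _ k] unfolding fixpoints_def by blast
    have "(tr i ^^ m) x \<star> k = x \<star> k"
      using y funpow_tr_translate[OF i k x(1)] x(2) unfolding fixpoints_def by simp
    then have "x \<in> fixpoints m i"
      using cancel[OF _ x(1) k] funpow_tr_closed[OF i x(1)] x(1) unfolding fixpoints_def by simp
    then show "y \<in> (\<lambda>x. x \<star> k) ` fixpoints m i" using x(2) by blast
  qed
qed

text \<open>Translation by \<open>k\<close> carries \<open>fixpoints m j\<close> to
  \<open>fixpoints m (j \<star> k)\<close>. If \<open>k\<close> belongs to the subquandle \<open>fixpoints m i\<close>, which is assumed to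
  equal \<open>fixpoints m j\<close>, this image is the set itself.\<close>

lemma fixpoints_translate_eq:
  assumes "i \<in> X" "j \<in> X" "fixpoints m j = fixpoints m i" "k \<in> fixpoints m i"
  shows "fixpoints m (j \<star> k) = fixpoints m i"
proof -
  have k: "k \<in> X" using assms(4) fixpoints_subset by blast
  have "inj_on (\<lambda>x. x \<star> k) (fixpoints m i)"
    using cancel[OF _ _ k] by (auto intro!: inj_onI dest: subsetD[OF fixpoints_subset])
  moreover have "(\<lambda>x. x \<star> k) ` fixpoints m i \<subseteq> fixpoints m i"
    using fixpoints_closed assms(1,4) by blast
  ultimately have "(\<lambda>x. x \<star> k) ` fixpoints m i = fixpoints m i"
    by (intro endo_inj_surj finite_fixpoints)
  then show ?thesis using fixpoints_translate[OF assms(2) k] assms(3) by simp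
qed

lemma class_map_fixpointsI:
  assumes "\<And>i y. i \<in> X \<Longrightarrow> y \<in> fixpoints m i \<Longrightarrow> fixpoints m y = fixpoints m i"
  shows "class_map X (fixpoints m)"
  unfolding class_map_def using assms fixpoints_subset self_in_fixpoints by blast

lemma fixpoints_eq_on_orbit:
  assumes i: "i \<in> X" and x: "x \<in> X" "fixpoints m x = fixpoints m i"
    and y: "y \<in> Orbits.orbit (tr i) x"
  shows "fixpoints m y = fixpoints m i"
proof -
  have "fixpoints m ((tr i ^^ n) x) = fixpoints m i" for n
  proof (induction n)
    case (Suc n)
    have "(tr i ^^ n) x \<in> X" using funpow_tr_closed i x(1) by blast
    then show ?case
      using fixpoints_translate_eq[OF i _ Suc self_in_fixpoints[OF i]] by (simp add: tr_apply)
  qed (simp add: x(2))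
  then show ?thesis using y orbit_tr[OF i x(1)] by auto
qed

end

section \<open>Cycle lengths and the profile\<close>

locale profiled_quandle = finite_connected_quandle +
  fixes l :: "nat list"
  assumes profile: "i \<in> X \<Longrightarrow> l = cycle_lengths X (right_translation X qop i)"
begin

lemma len_in: "i \<in> X \<Longrightarrow> x \<in> X \<Longrightarrow> len i x \<in> set l"
  using profile set_cycle_lengths by blast

lemma ex_len: "i \<in> X \<Longrightarrow> m \<in> set l \<Longrightarrow> \<exists>x\<in>X. len i x = m"
  using profile[of i] set_cycle_lengths[of i] by auto

lemma card_fixpoints: "i \<in> X \<Longrightarrow> card (fixpoints m i) = sum_mset {#n \<in># mset l. n dvd m#}"
proof -
  assume i: "i \<in> X"
  have "fixpoints m i = {x \<in> X. len i x dvd m}" using fixpoints_iff[OF i] by blast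
  then show ?thesis using card_len_eq_sum[OF i profile[OF i]] by simp
qed

lemma orbit_eq_if_count_one:
  assumes i: "i \<in> X" and c: "count (mset l) m = 1"
    and x: "x \<in> X" "len i x = m"
  shows "Orbits.orbit (tr i) x = {y \<in> X. len i y = m}"
proof (rule card_subset_eq)
  show "finite {y \<in> X. len i y = m}" using finite_X by simp
  show "Orbits.orbit (tr i) x \<subseteq> {y \<in> X. len i y = m}"
    using orbit_tr_subset[OF i x(1)] len_orbit[OF i] x(2) by auto
  have "{#n \<in># mset l. n = m#} = replicate_mset (count (mset l) m) m"
    by (rule filter_eq_replicate_mset)
  then have "card {y \<in> X. len i y = m} = m"
    using card_len_eq_sum[OF i profile[OF i], of "\<lambda>n. n = m"] c by simp
  then show "card (Orbits.orbit (tr i) x) = card {y \<in> X. len i y = m}"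
    using x(2) by (simp add: len_def)
qed

lemma fixpoints_one:
  assumes "count (mset l) 1 = 1" and i: "i \<in> X"
  shows "fixpoints 1 i = {i}"
proof -
  have "fixpoints 1 i = {y \<in> X. len i y = 1}" using fixpoints_iff[OF i] by auto
  also have "\<dots> = Orbits.orbit (tr i) i"
    using orbit_eq_if_count_one[OF i assms(1) i len_self[OF i]] by simp
  also have "\<dots> = {i}"
    using idem[OF i] i by (simp only: orbit_eq_singleton_iff) (simp add: tr_def)
  finally show ?thesis .
qed

lemma translate_neq:
  assumes "count (mset l) 1 = 1" "i \<in> X" "k \<in> X" "i \<noteq> k"
  shows "i \<star> k \<noteq> i"
proof
  assume "i \<star> k = i"
  then have "i \<in> fixpoints 1 k" using assms(2) unfolding fixpoints_def by (simp add: tr_def)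
  then show False using fixpoints_one[OF assms(1,3)] assms(4) by simp
qed

section \<open>When the sets of fixed points are equivalence classes\<close>

text \<open>Here \<open>fixpoints m i\<close> consists of \<open>i\<close> and one further cycle. For \<open>y\<close> in this cycle
  the translation by \<open>y\<close> moves \<open>i\<close>, hence into the cycle. So some point of the cycle has the same
  set of fixed points as \<open>i\<close>, and then all its points do, by translating by \<open>i\<close>.\<close>

lemma class_map_fixpoints_single_cycle:
  assumes c: "count (mset l) 1 = 1" "count (mset l) m = 1"
    and m: "\<And>n. n \<in> set l \<Longrightarrow> n dvd m \<Longrightarrow> n = 1 \<or> n = m"
  shows "class_map X (fixpoints m)"
proof (rule class_map_fixpointsI)
  fix i y assume i: "i \<in> X" and y: "y \<in> fixpoints m i"
  have len: "len i z = m" if "z \<in> fixpoints m i" "z \<noteq> i" for z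
  proof -
    have z: "z \<in> X" "len i z dvd m" using that fixpoints_iff[OF i] by auto
    have "len i z \<noteq> 1"
      using fixpoints_one[OF c(1) i] fixpoints_iff[OF i, of z 1] z that(2) by auto
    then show ?thesis using m[OF len_in[OF i z(1)] z(2)] by simp
  qed
  have yX: "y \<in> X" using y fixpoints_subset by blast
  show "fixpoints m y = fixpoints m i"
  proof (cases "y = i")
    case False
    let ?x = "i \<star> y"
    have x: "?x \<in> fixpoints m i" using fixpoints_closed[OF i self_in_fixpoints[OF i] y] .
    have xX: "?x \<in> X" using closed i yX by blast
    have "?x \<noteq> i" using translate_neq[OF c(1) i yX] False by blast
    then have "y \<in> Orbits.orbit (tr i) ?x"
      using orbit_eq_if_count_one[OF i c(2) xX] len x y yX False by auto
    moreover have "fixpoints m ?x = fixpoints m i"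
      using fixpoints_translate_eq[OF i i refl y] .
    ultimately show ?thesis using fixpoints_eq_on_orbit[OF i xX] by blast
  qed simp
qed

text \<open>Let \<open>T\<close> be the set of all \<open>j\<close> with \<open>fixpoints m j = fixpoints m i\<close>, and suppose
  that \<open>k\<close> lies in \<open>fixpoints m i\<close> but not in \<open>T\<close>. Both translations, by \<open>i\<close> and by \<open>k\<close>, preserve
  \<open>T\<close>. The translation by \<open>i\<close> has the fixed point \<open>i\<close> in \<open>T\<close> and otherwise cycles whose length is a
  multiple of \<open>e\<close>, so that \<open>card T\<close> is \<open>1\<close> modulo \<open>e\<close>. The translation by \<open>k\<close> has no fixed point
  in \<open>T\<close>. If it had a cycle there whose length \<open>n\<close> is not a multiple of \<open>e\<close>, a point \<open>j\<close> of this
  cycle would be equivalent to \<open>k\<close> with respect to \<open>n\<close>, while \<open>k\<close> is in \<open>fixpoints m j\<close>; as \<open>n\<close> and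
  \<open>m\<close> share only the divisor \<open>1\<close> among the lengths, this forces \<open>j = k\<close>. So \<open>card T\<close> is \<open>0\<close>
  modulo \<open>e\<close> as well.\<close>

lemma class_map_fixpoints_common_divisor:
  assumes c: "count (mset l) 1 = 1" and e: "2 \<le> e"
    and m: "\<And>n. n \<in> set l \<Longrightarrow> n dvd m \<Longrightarrow> n = 1 \<or> e dvd n"
    and other: "\<And>n. n \<in> set l \<Longrightarrow> \<not> e dvd n \<Longrightarrow> n \<noteq> 1 \<Longrightarrow> class_map X (fixpoints n)"
      "\<And>n r. n \<in> set l \<Longrightarrow> \<not> e dvd n \<Longrightarrow> r \<in> set l \<Longrightarrow> r dvd n \<Longrightarrow> r dvd m \<Longrightarrow> r = 1"
  shows "class_map X (fixpoints m)"
proof (rule class_map_fixpointsI, rule ccontr)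
  fix i k assume i: "i \<in> X" and k: "k \<in> fixpoints m i" and neq: "fixpoints m k \<noteq> fixpoints m i"
  define T where "T = {j \<in> X. fixpoints m j = fixpoints m i}"
  have TX: "T \<subseteq> X" and iT: "i \<in> T" using i by (auto simp: T_def)
  have kX: "k \<in> X" using k fixpoints_subset by blast
  have T_closed: "j \<star> h \<in> T" if "j \<in> T" "h \<in> fixpoints m i" for j h
    using that fixpoints_translate_eq[OF i] closed fixpoints_subset unfolding T_def by blast
  have one: "x = i" if "i \<in> X" "x \<in> X" "len i x = 1" for i x
    using fixpoints_one[OF c that(1)] fixpoints_iff[OF that(1), of x 1] that by auto
  have "e dvd card T"
  proof (rule dvd_card_if_dvd_len[OF kX TX])
    fix j assume j: "j \<in> T"
    have jX: "j \<in> X" using j TX by blast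
    have jm: "fixpoints m j = fixpoints m i" using j unfolding T_def by blast
    show "j \<star> k \<in> T" using T_closed j k by blast
    show "e dvd len k j"
    proof (rule ccontr)
      assume ndvd: "\<not> e dvd len k j"
      let ?n = "len k j"
      have n: "?n \<in> set l" using len_in kX jX by blast
      have "j \<noteq> k" using jm neq by blast
      then have "?n \<noteq> 1" using one[OF kX jX] by blast
      then have cm: "class_map X (fixpoints ?n)" using other(1)[OF n ndvd] by blast
      have "j \<in> fixpoints ?n k" using fixpoints_iff[OF kX] jX by simp
      then have "fixpoints ?n j = fixpoints ?n k" by (rule class_map_eq[OF cm kX])
      then have "k \<in> fixpoints ?n j" using self_in_fixpoints[OF kX] by simp
      moreover have "k \<in> fixpoints m j" using k jm by simp
      ultimately have "len j k dvd ?n" "len j k dvd m" using fixpoints_iff[OF jX] by auto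
      then have "len j k = 1" using other(2)[OF n ndvd len_in[OF jX kX]] by blast
      then show False using one[OF jX kX] \<open>j \<noteq> k\<close> by simp
    qed
  qed
  moreover have "e dvd card (T - {i})"
  proof (rule dvd_card_if_dvd_len[OF i])
    show "T - {i} \<subseteq> X" using TX by blast
    fix j assume j: "j \<in> T - {i}"
    have jX: "j \<in> X" using j TX by blast
    have "j \<star> i \<noteq> i"
    proof
      assume "j \<star> i = i"
      then have "j = i" using cancel[OF jX i i] idem[OF i] by simp
      then show False using j by blast
    qed
    then show "j \<star> i \<in> T - {i}" using T_closed j self_in_fixpoints[OF i] by blast
    have "j \<in> fixpoints m i" using j self_in_fixpoints[OF jX, of m] unfolding T_def by auto
    then have "len i j dvd m" using fixpoints_iff[OF i] by blast
    moreover have "len i j \<noteq> 1" using one[OF i jX] j by blast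
    ultimately show "e dvd len i j" using m[OF len_in[OF i jX]] by blast
  qed
  moreover have "card T = Suc (card (T - {i}))"
    using card.remove[OF finite_subset[OF TX finite_X] iT] .
  ultimately have "e dvd 1" by (metis dvd_add_right_iff plus_1_eq_Suc add.commute)
  then show False using e by simp
qed


text \<open>If a translation has exactly two fixed points, \<open>X\<close> splits into pairs, the sets
  \<open>fixpoints 1 x\<close>, and automorphisms permute these pairs. So a power of a translation that fixes \<open>x\<close>
  also fixes its partner \<open>y\<close>.\<close>

lemma pair_partner_len:
  assumes c2: "\<And>i. i \<in> X \<Longrightarrow> card (fixpoints 1 i) = 2"
    and i: "i \<in> X" and x: "x \<in> X" and y: "y \<in> fixpoints 1 x"
  shows "len i y dvd len i x"
proof (cases "y = x")
  case False
  let ?f = "tr i ^^ len i x"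
  have yX: "y \<in> X" using y fixpoints_subset by blast
  have fx: "?f x = x" using fixpoints_iff[OF i, of x "len i x"] x unfolding fixpoints_def by simp
  have "y \<star> x = y" using y yX unfolding fixpoints_def by (simp add: tr_apply)
  then have "?f y \<star> x = ?f y" using funpow_tr_hom[OF i yX x, of "len i x"] fx by simp
  then have "?f y \<in> fixpoints 1 x"
    using funpow_tr_closed[OF i yX] unfolding fixpoints_def by (simp add: tr_apply)
  moreover have "fixpoints 1 x = {x, y}"
    using c2[OF x] self_in_fixpoints[OF x, of 1] y False by (auto simp: card_2_iff)
  moreover have "?f y \<noteq> x"
  proof
    assume "?f y = x"
    then have "?f y = ?f x" using fx by simp
    moreover have "inj ?f"
      using permutation_bijective[OF tr_permutation[OF i]] by (intro inj_fn) (rule bij_is_inj)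
    ultimately show False using False by (meson injD)
  qed
  ultimately have "?f y = y" by blast
  then have "y \<in> fixpoints (len i x) i" using yX unfolding fixpoints_def by simp
  then show ?thesis using fixpoints_iff[OF i] by blast
qed simp

text \<open>If \<open>j\<close> is the second fixed point of the translation by \<open>i\<close>, then \<open>i \<star> j\<close> is \<open>i\<close> or \<open>j\<close>, since
  \<open>{i, j}\<close> is a subquandle. It is not \<open>j = j \<star> j\<close>, so \<open>i\<close> is the second fixed point of the
  translation by \<open>j\<close>.\<close>

lemma class_map_pairs:
  assumes c2: "\<And>i. i \<in> X \<Longrightarrow> card (fixpoints 1 i) = 2"
  shows "class_map X (fixpoints 1)"
proof (rule class_map_fixpointsI)
  fix i j assume i: "i \<in> X" and j: "j \<in> fixpoints 1 i"
  have jX: "j \<in> X" using j fixpoints_subset by blast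
  show "fixpoints 1 j = fixpoints 1 i"
  proof (cases "j = i")
    case False
    have ij: "fixpoints 1 i = {i, j}"
      using c2[OF i] self_in_fixpoints[OF i, of 1] j False by (auto simp: card_2_iff)
    have "i \<star> j \<in> {i, j}" using fixpoints_closed[OF i self_in_fixpoints[OF i] j] ij by simp
    moreover have "i \<star> j \<noteq> j" using cancel[OF i jX jX] idem[OF jX] False by auto
    ultimately have "i \<in> fixpoints 1 j" using i unfolding fixpoints_def by (simp add: tr_apply)
    then have "fixpoints 1 j = {i, j}"
      using c2[OF jX] self_in_fixpoints[OF jX, of 1] False by (auto simp: card_2_iff)
    then show ?thesis using ij by simp
  qed simp
qed

text \<open>The points in cycles of length \<open>m\<close> form a union of pairs, and here there are \<open>m\<close>
  of them.\<close>

lemma even_len_if_pairs: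
  assumes c2: "\<And>i. i \<in> X \<Longrightarrow> card (fixpoints 1 i) = 2"
    and i: "i \<in> X" and m: "m \<in> set l" "count (mset l) m = 1"
  shows "even m"
proof -
  let ?N = "{x \<in> X. len i x = m}"
  note cm = class_map_pairs[OF c2]
  obtain x where x: "x \<in> X" "len i x = m" using ex_len[OF i m(1)] by blast
  have card: "card ?N = m"
    using orbit_eq_if_count_one[OF i m(2) x] x(2) by (simp add: len_def)
  have sub: "fixpoints 1 z \<subseteq> ?N" if z: "z \<in> ?N" for z
  proof
    fix y assume y: "y \<in> fixpoints 1 z"
    have X: "z \<in> X" "y \<in> X" using z y fixpoints_subset by auto
    have "z \<in> fixpoints 1 y" using class_map_eq[OF cm X(1) y] self_in_fixpoints[OF X(1)] by simp
    then have "len i y = len i z"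
      using pair_partner_len[OF c2 i] X y by (meson dvd_antisym)
    then show "y \<in> ?N" using z X by simp
  qed
  have U: "?N = \<Union> (fixpoints 1 ` ?N)" using sub self_in_fixpoints[of _ 1] by blast
  have "2 dvd card (\<Union> (fixpoints 1 ` ?N))"
  proof (rule dvd_partition)
    show "finite (\<Union> (fixpoints 1 ` ?N))" using U finite_X by simp
    show "\<forall>c\<in>fixpoints 1 ` ?N. 2 dvd card c" using c2 by auto
    show "\<forall>c1\<in>fixpoints 1 ` ?N. \<forall>c2\<in>fixpoints 1 ` ?N. c1 \<noteq> c2 \<longrightarrow> c1 \<inter> c2 = {}"
    proof (intro ballI impI, rule ccontr)
      fix c1 c2 assume "c1 \<in> fixpoints 1 ` ?N" "c2 \<in> fixpoints 1 ` ?N"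
        and ne: "c1 \<noteq> c2" "c1 \<inter> c2 \<noteq> {}"
      then obtain u v w where "u \<in> X" "v \<in> X" "c1 = fixpoints 1 u" "c2 = fixpoints 1 v"
        "w \<in> fixpoints 1 u" "w \<in> fixpoints 1 v" by blast
      then show False
        using class_map_eq[OF cm, of u w] class_map_eq[OF cm, of v w] ne(1) by simp
    qed
  qed
  then show ?thesis using U card by simp
qed

text \<open>Now \<open>fixpoints m i\<close> consists of the pair of \<open>i\<close> and one cycle. Translation by a point
  \<open>k\<close> of this cycle moves \<open>i\<close>. It cannot exchange \<open>i\<close> with its partner, as there is no cycle of
  length \<open>2\<close>. So it moves \<open>i\<close> into the cycle, all of whose points then have the same set of fixed
  points as \<open>i\<close>. The partner of \<open>i\<close> is moved into the cycle as well, and undoing the translation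
  transfers the property to the partner.\<close>

lemma class_map_fixpoints_pairs:
  assumes c2: "\<And>i. i \<in> X \<Longrightarrow> card (fixpoints 1 i) = 2"
    and m: "m \<in> set l" "m \<noteq> 1" "count (mset l) m = 1"
      "\<And>n. n \<in> set l \<Longrightarrow> n dvd m \<Longrightarrow> n = 1 \<or> n = m"
    and two: "2 \<notin> set l"
  shows "class_map X (fixpoints m)"
proof (rule class_map_fixpointsI)
  fix i y assume i: "i \<in> X" and y: "y \<in> fixpoints m i"
  note cm = class_map_pairs[OF c2]
  obtain k where k: "k \<in> X" "len i k = m" using ex_len[OF i m(1)] by blast
  have km: "k \<in> fixpoints m i" using fixpoints_iff[OF i] k by simp
  have ik: "i \<notin> fixpoints 1 k"
  proof
    assume "i \<in> fixpoints 1 k"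
    then have "k \<in> fixpoints 1 i"
      using class_map_eq[OF cm k(1)] self_in_fixpoints[OF k(1)] by blast
    then show False using fixpoints_iff[OF i] k(2) m(2) by simp
  qed
  let ?x = "i \<star> k"
  have xX: "?x \<in> X" using closed i k(1) .
  have xi: "?x \<noteq> i" using ik i unfolding fixpoints_def by (auto simp: tr_apply)
  have xm: "?x \<in> fixpoints m i" using fixpoints_closed[OF i self_in_fixpoints[OF i] km] .
  have fx: "fixpoints m ?x = fixpoints m i" using fixpoints_translate_eq[OF i i refl km] .
  have "?x \<notin> fixpoints 1 i"
  proof
    assume x1: "?x \<in> fixpoints 1 i"
    \<comment> \<open>The pair of \<open>i\<close> is then \<open>{i, i \<star> k}\<close>, and translation by \<open>k\<close> exchanges its elements.\<close>
    have "?x \<star> k \<in> fixpoints 1 ?x" using fixpoints_translate[OF i k(1)] x1 by blast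
    then have "?x \<star> k \<in> fixpoints 1 i" using class_map_eq[OF cm i x1] by simp
    moreover have "fixpoints 1 i = {i, ?x}"
      using c2[OF i] self_in_fixpoints[OF i, of 1] x1 xi by (auto simp: card_2_iff)
    moreover have "?x \<star> k \<noteq> ?x" using cancel[OF xX i k(1)] xi by blast
    ultimately have "?x \<star> k = i" by blast
    then have "i \<in> fixpoints 2 k"
      using i xX unfolding fixpoints_def by (simp add: tr_apply numeral_2_eq_2)
    then have "len k i dvd 2" using fixpoints_iff[OF k(1)] by blast
    moreover have "len k i \<noteq> 1" using ik fixpoints_iff[OF k(1), of i 1] i by simp
    moreover have "len k i \<le> 2" using \<open>len k i dvd 2\<close> by (rule dvd_imp_le) simp
    ultimately have "len k i = 2" using len_pos[OF k(1) i] by linarith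
    then show False using len_in[OF k(1) i] two by simp
  qed
  then have "len i ?x \<noteq> 1" using fixpoints_iff[OF i, of ?x 1] xX by simp
  moreover have "len i ?x dvd m" using xm fixpoints_iff[OF i] by blast
  ultimately have lx: "len i ?x = m" using m(4)[OF len_in[OF i xX]] by blast
  have on_cycle: "fixpoints m z = fixpoints m i" if "z \<in> X" "len i z = m" for z
    using fixpoints_eq_on_orbit[OF i xX fx] orbit_eq_if_count_one[OF i m(3) xX lx] that by blast
  have yX: "y \<in> X" and "len i y dvd m" using y fixpoints_iff[OF i] by auto
  then consider "len i y = 1" | "len i y = m" using m(4)[OF len_in[OF i]] by blast
  then show "fixpoints m y = fixpoints m i"
  proof cases
    case 1
    then have "y \<in> fixpoints 1 i" using fixpoints_iff[OF i] yX by simp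
    then have yk: "y \<star> k \<in> fixpoints 1 ?x" using fixpoints_translate[OF i k(1)] by blast
    have ykX: "y \<star> k \<in> X" using closed yX k(1) .
    have "?x \<in> fixpoints 1 (y \<star> k)"
      using class_map_eq[OF cm xX yk] self_in_fixpoints[OF xX] by simp
    then have "len i (y \<star> k) = len i ?x"
      using pair_partner_len[OF c2 i] xX ykX yk by (meson dvd_antisym)
    then have "fixpoints m (y \<star> k) = fixpoints m ?x" using on_cycle[OF ykX] lx fx by simp
    then have "(\<lambda>x. x \<star> k) ` fixpoints m y = (\<lambda>x. x \<star> k) ` fixpoints m i"
      using fixpoints_translate[OF yX k(1)] fixpoints_translate[OF i k(1)] by simp
    moreover have "inj_on (\<lambda>x. x \<star> k) X" using cancel k(1) by (auto intro: inj_onI)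
    ultimately show ?thesis
      using inj_on_image_eq_iff[OF _ fixpoints_subset fixpoints_subset] by blast
  next
    case 2
    then show ?thesis using on_cycle yX by blast
  qed
qed

section \<open>Excluding several maximal lengths\<close>

lemma card_fixpoints_three_class_maps:
  assumes abd: "a \<in> set l" "b \<in> set l" "d \<in> set l"
    and anti: "\<not> a dvd b" "\<not> a dvd d" "\<not> b dvd a" "\<not> b dvd d" "\<not> d dvd a" "\<not> d dvd b"
    and cm: "class_map X (fixpoints a)" "class_map X (fixpoints b)" "class_map X (fixpoints d)"
    and cover: "\<And>n. n \<in> set l \<Longrightarrow> n dvd a \<or> n dvd b \<or> n dvd d"
    and i: "i \<in> X"
  shows "card (fixpoints a i) = 2 * card (fixpoints a i \<inter> fixpoints b i \<inter> fixpoints d i)"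
proof -
  let ?f = "\<lambda>i. card (fixpoints a i \<inter> fixpoints b i \<inter> fixpoints d i)"
  have f: "?f j = sum_mset {#n \<in># mset l. n dvd a \<and> n dvd b \<and> n dvd d#}" if j: "j \<in> X" for j
  proof -
    have "fixpoints a j \<inter> fixpoints b j \<inter> fixpoints d j
      = {x \<in> X. len j x dvd a \<and> len j x dvd b \<and> len j x dvd d}"
      using fixpoints_iff[OF j] by blast
    then show ?thesis
      using card_len_eq_sum[OF j profile[OF j], of "\<lambda>n. n dvd a \<and> n dvd b \<and> n dvd d"] by simp
  qed
  have only_in: "fixpoints p j - (fixpoints q j \<union> fixpoints r j) \<noteq> {}"
    if j: "j \<in> X" and p: "p \<in> set l" "\<not> p dvd q" "\<not> p dvd r" for j p q r
  proof -
    obtain x where "x \<in> X" "len j x = p" using ex_len[OF j p(1)] by blast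
    then have "x \<in> fixpoints p j - (fixpoints q j \<union> fixpoints r j)"
      using p(2,3) by (simp add: fixpoints_iff[OF j])
    then show ?thesis by blast
  qed
  show ?thesis
  proof (rule card_three_class_maps[OF finite_X cm])
    show "fixpoints a x \<union> fixpoints b x \<union> fixpoints d x = X" if x: "x \<in> X" for x
      using cover len_in[OF x] fixpoints_iff[OF x] by blast
    show "?f x = ?f i" if "x \<in> X" for x using f[OF that] f[OF i] by simp
  qed (use only_in abd anti i in blast)+
qed

lemma no_three_class_maps:
  assumes i: "i \<in> X" and anti: "dvd_antichain {p, q, r}" "distinct [p, q, r]"
    and in_l: "p \<in> set l" "q \<in> set l" "r \<in> set l"
    and cm: "\<And>m. m \<in> {p, q, r} \<Longrightarrow> class_map X (fixpoints m)"
    and cover: "\<And>n. n \<in> set l \<Longrightarrow> n dvd p \<or> n dvd q \<or> n dvd r"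
    and sizes: "\<not> (card (fixpoints p i) = card (fixpoints q i) \<and>
      card (fixpoints p i) = card (fixpoints r i))"
  shows False
proof -
  note not_dvd = dvd_antichain_three[OF anti]
  let ?E = "fixpoints p i \<inter> fixpoints q i \<inter> fixpoints r i"
  have "card (fixpoints p i) = 2 * card ?E"
    by (rule card_fixpoints_three_class_maps) (use in_l not_dvd cm cover i in auto)
  moreover have "card (fixpoints q i) = 2 * card (fixpoints q i \<inter> fixpoints p i \<inter> fixpoints r i)"
    by (rule card_fixpoints_three_class_maps) (use in_l not_dvd cm cover i in auto)
  moreover have "card (fixpoints r i) = 2 * card (fixpoints r i \<inter> fixpoints p i \<inter> fixpoints q i)"
    by (rule card_fixpoints_three_class_maps) (use in_l not_dvd cm cover i in auto)
  ultimately show False using sizes by (simp add: Int_ac)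
qed

lemma profile_neq_one_and_antichain:
  assumes i: "i \<in> X" and anti: "dvd_antichain {p, q, r}" "distinct [p, q, r]"
  shows "mset l \<noteq> {#1, p, q, r#}"
proof
  assume l: "mset l = {#1, p, q, r#}"
  have set_l: "set l = {1, p, q, r}" using arg_cong[OF l, of set_mset] by simp
  note not_dvd = dvd_antichain_three[OF anti]
  have neq1: "p \<noteq> 1" "q \<noteq> 1" "r \<noteq> 1" using not_dvd by auto
  show False
  proof (rule no_three_class_maps[OF i anti])
    show "p \<in> set l" "q \<in> set l" "r \<in> set l" unfolding set_l by auto
    show "class_map X (fixpoints m)" if m: "m \<in> {p, q, r}" for m
    proof (rule class_map_fixpoints_single_cycle)
      show "count (mset l) 1 = 1" unfolding l using neq1 by simp
      show "count (mset l) m = 1" unfolding l using m neq1 anti(2) by auto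
      show "n = 1 \<or> n = m" if "n \<in> set l" "n dvd m" for n
        using that m not_dvd unfolding set_l by auto
    qed
    show "n dvd p \<or> n dvd q \<or> n dvd r" if "n \<in> set l" for n
      using that unfolding set_l by auto
    have "card (fixpoints p i) = 1 + p" "card (fixpoints q i) = 1 + q"
      using not_dvd unfolding card_fixpoints[OF i] l by simp_all
    then show "\<not> (card (fixpoints p i) = card (fixpoints q i) \<and>
      card (fixpoints p i) = card (fixpoints r i))" using anti(2) by simp
  qed
qed

lemma profile_neq_two_ones_and_antichain:
  assumes i: "i \<in> X" and anti: "dvd_antichain {p, q, r}" "distinct [p, q, r]"
  shows "mset l \<noteq> {#1, p, q, r, 1#}"
proof
  assume l: "mset l = {#1, p, q, r, 1#}"
  have set_l: "set l = {1, p, q, r}" using arg_cong[OF l, of set_mset] by auto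
  note not_dvd = dvd_antichain_three[OF anti]
  have neq1: "p \<noteq> 1" "q \<noteq> 1" "r \<noteq> 1" using not_dvd by auto
  have in_l: "p \<in> set l" "q \<in> set l" "r \<in> set l" unfolding set_l by auto
  have c2: "card (fixpoints 1 j) = 2" if "j \<in> X" for j
    using neq1 unfolding card_fixpoints[OF that] l by simp
  have count: "count (mset l) m = 1" if "m \<in> {p, q, r}" for m
    using that neq1 anti(2) unfolding l by auto
  have "even p" "even q" "even r" using even_len_if_pairs[OF c2 i] in_l count by auto
  \<comment> \<open>If one of these even lengths were \<open>2\<close>, it would divide the others.\<close>
  then have two: "2 \<notin> set l" using not_dvd unfolding set_l by auto
  show False
  proof (rule no_three_class_maps[OF i anti in_l])
    show "class_map X (fixpoints m)" if m: "m \<in> {p, q, r}" for m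
    proof (rule class_map_fixpoints_pairs[OF c2])
      show "m \<in> set l" "m \<noteq> 1" using m in_l neq1 by auto
      show "n = 1 \<or> n = m" if "n \<in> set l" "n dvd m" for n
        using that m not_dvd unfolding set_l by auto
    qed (use count[OF m] two in auto)
    show "n dvd p \<or> n dvd q \<or> n dvd r" if "n \<in> set l" for n
      using that unfolding set_l by auto
    have "card (fixpoints p i) = 2 + p" "card (fixpoints q i) = 2 + q"
      using not_dvd unfolding card_fixpoints[OF i] l by simp_all
    then show "\<not> (card (fixpoints p i) = card (fixpoints q i) \<and>
      card (fixpoints p i) = card (fixpoints r i))" using anti(2) by simp
  qed
qed

text \<open>This includes the case that \<open>e\<close> is a second copy of one of the maximal lengths. The
  lengths that are not multiples of \<open>e\<close> come first: \<open>class_map_fixpoints_common_divisor\<close> relies on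
  them for the others.\<close>

lemma profile_neq_antichain_and_divisor:
  assumes i: "i \<in> X" and anti: "dvd_antichain {p, q, r}" "distinct [p, q, r]"
    and e2: "2 \<le> e" and e_dvd: "e dvd p \<or> e dvd q \<or> e dvd r"
  shows "mset l \<noteq> {#1, p, q, r, e#}"
proof
  assume l: "mset l = {#1, p, q, r, e#}"
  have set_l: "set l = {1, p, q, r, e}" using arg_cong[OF l, of set_mset] by simp
  note not_dvd = dvd_antichain_three[OF anti]
  have neq1: "p \<noteq> 1" "q \<noteq> 1" "r \<noteq> 1" using not_dvd by auto
  have count1: "count (mset l) 1 = 1" unfolding l using neq1 e2 by simp
  have not_multiple: "class_map X (fixpoints m)" if m: "m \<in> {p, q, r}" "\<not> e dvd m" for m
  proof (rule class_map_fixpoints_single_cycle[OF count1])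
    have "e \<noteq> m" using m(2) by auto
    then show "count (mset l) m = 1" unfolding l using m(1) neq1 anti(2) by auto
    show "n = 1 \<or> n = m" if "n \<in> set l" "n dvd m" for n
      using that m not_dvd unfolding set_l by auto
  qed
  show False
  proof (rule no_three_class_maps[OF i anti])
    show "p \<in> set l" "q \<in> set l" "r \<in> set l" unfolding set_l by auto
    show "class_map X (fixpoints m)" if m: "m \<in> {p, q, r}" for m
    proof (cases "e dvd m")
      case True
      show ?thesis
      proof (rule class_map_fixpoints_common_divisor[OF count1 e2])
        show "n = 1 \<or> e dvd n" if "n \<in> set l" "n dvd m" for n
          using that m True not_dvd unfolding set_l by auto
        show "class_map X (fixpoints n)" if "n \<in> set l" "\<not> e dvd n" "n \<noteq> 1" for n
          using that unfolding set_l by (intro not_multiple) auto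
        show "s = 1" if "n \<in> set l" "\<not> e dvd n" "s \<in> set l" "s dvd n" "s dvd m" for n s
          using that m True not_dvd unfolding set_l by auto
      qed
    qed (rule not_multiple[OF m])
    show "n dvd p \<or> n dvd q \<or> n dvd r" if "n \<in> set l" for n
      using that e_dvd unfolding set_l by auto
    have "card (fixpoints m i) = 1 + m + (if e dvd m then e else 0)" if "m \<in> {p, q, r}" for m
      using not_dvd that unfolding card_fixpoints[OF i] l by auto
    \<comment> \<open>Two of the three distinct lengths agree on being a multiple of \<open>e\<close>.\<close>
    then show "\<not> (card (fixpoints p i) = card (fixpoints q i) \<and>
      card (fixpoints p i) = card (fixpoints r i))"
      using anti(2) by (auto split: if_splits)
  qed
qed

lemma profile_neq_one_and_four_antichain:
  assumes i: "i \<in> X" and anti: "dvd_antichain {p, q, r, e}" "distinct [p, q, r, e]"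
  shows "mset l \<noteq> {#1, p, q, r, e#}"
proof
  assume l: "mset l = {#1, p, q, r, e#}"
  have set_l: "set l = {1, p, q, r, e}" using arg_cong[OF l, of set_mset] by simp
  have not_dvd: "\<not> u dvd v" if "u \<in> {p, q, r, e}" "v \<in> {p, q, r, e}" "u \<noteq> v" for u v
    using anti(1) that unfolding dvd_antichain_def by blast
  have neq1: "1 \<notin> {p, q, r, e}"
  proof
    assume 1: "1 \<in> {p, q, r, e}"
    then have "p = 1" "q = 1" using not_dvd[OF 1, of p] not_dvd[OF 1, of q] by auto
    then show False using anti(2) by simp
  qed
  have count1: "count (mset l) 1 = 1" unfolding l using neq1 by simp
  have single: "n = 1 \<or> n = m" if "m \<in> {p, q, r, e}" "n \<in> set l" "n dvd m" for m n
    using that(2) not_dvd[OF _ that(1), of n] that(3) unfolding set_l by blast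
  have cm: "class_map X (fixpoints m)" if m: "m \<in> {p, q, r, e}" for m
  proof (rule class_map_fixpoints_single_cycle[OF count1])
    show "count (mset l) m = 1" unfolding l using m neq1 anti(2) by auto
  qed (rule single[OF m])
  have triv: "fixpoints u j \<inter> fixpoints v j = {j}"
    if uv: "u \<in> {p, q, r, e}" "v \<in> {p, q, r, e}" "u \<noteq> v" and j: "j \<in> X" for u v j
  proof -
    have "x = j" if x: "x \<in> fixpoints u j \<inter> fixpoints v j" for x
    proof -
      have xX: "x \<in> X" and dvd: "len j x dvd u" "len j x dvd v" using x fixpoints_iff[OF j] by auto
      then have "len j x = 1"
        using single[OF uv(1) len_in[OF j xX]] single[OF uv(2) len_in[OF j xX]] uv(3) by metis
      then have "x \<in> fixpoints 1 j" using fixpoints_iff[OF j] xX by simp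
      then show ?thesis using fixpoints_one[OF count1 j] by simp
    qed
    then show ?thesis using self_in_fixpoints[OF j] by blast
  qed
  have cover: "fixpoints p j \<union> fixpoints q j \<union> fixpoints r j \<union> fixpoints e j = X"
    if j: "j \<in> X" for j
  proof
    show "X \<subseteq> fixpoints p j \<union> fixpoints q j \<union> fixpoints r j \<union> fixpoints e j"
    proof
      fix x assume "x \<in> X"
      then show "x \<in> fixpoints p j \<union> fixpoints q j \<union> fixpoints r j \<union> fixpoints e j"
        using len_in[OF j, of x] unfolding set_l Un_iff fixpoints_iff[OF j] by auto
    qed
  qed (intro Un_least fixpoints_subset)
  have card: "card (fixpoints p i) = 1 + p" "card (fixpoints q i) = 1 + q"
    using not_dvd[of _ p] not_dvd[of _ q] anti(2) unfolding card_fixpoints[OF i] l by auto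
  have zero: "0 \<notin> set l" using ex_len[OF i] len_pos[OF i] by (metis less_irrefl)
  have pos: "0 < p" "0 < q" using zero unfolding set_l by auto
  have "card (fixpoints p i) \<le> 3"
  proof (rule card_four_class_maps[OF finite_X cm[of p] cm[of q] cm[of r] cm[of e] cover _ _ _ i])
    show "fixpoints q i \<noteq> {i}" using card(2) pos by auto
  qed (use anti(2) in \<open>simp_all add: triv\<close>)
  moreover have "card (fixpoints q i) \<le> 3"
  proof (rule card_four_class_maps[OF finite_X cm[of q] cm[of p] cm[of r] cm[of e] _ _ _ _ i])
    show "fixpoints p i \<noteq> {i}" using card(1) pos by auto
    show "fixpoints q j \<union> fixpoints p j \<union> fixpoints r j \<union> fixpoints e j = X" if "j \<in> X" for j
      using cover[OF that] by (simp only: Un_commute[of "fixpoints q j"])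
  qed (use anti(2) in \<open>simp_all add: triv\<close>)
  \<comment> \<open>So \<open>p\<close> and \<open>q\<close> are both \<open>2\<close>.\<close>
  ultimately show False using card pos neq1 anti(2) by auto
qed

text \<open>The lengths that are maximal with respect to divisibility form an antichain, and every
  length divides one of them. One maximal length would be a common multiple. Two are impossible,
  because the two sets of points fixed by the corresponding powers of a translation would cover
  \<open>X\<close>. With at least three, at most one length besides \<open>1\<close> and these three is left, and the
  preceding lemmas exclude every possibility for it.\<close>

lemma ex_common_multiple:
  assumes i: "i \<in> X" and len5: "length l \<le> 5"
  shows "\<exists>m\<in>set l. \<forall>n\<in>set l. n dvd m"
proof (rule ccontr)
  assume neg: "\<not> ?thesis"
  have zero: "0 \<notin> set l" using ex_len[OF i] len_pos[OF i] by (metis less_irrefl)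
  have one: "1 \<in> set l" using len_in[OF i i] len_self[OF i] by simp
  define M where "M = {m \<in> set l. \<forall>k\<in>set l. m dvd k \<longrightarrow> k = m}"
  have above: "\<exists>m\<in>M. n dvd m" if "n \<in> set l" for n
    using finite_dvd_maximal[OF _ zero that] unfolding M_def by blast
  have M_antichain: "dvd_antichain S" if "S \<subseteq> M" for S
    using that unfolding M_def dvd_antichain_def by blast
  obtain p where p: "p \<in> M" using above[OF one] by blast
  then obtain n where n: "n \<in> set l" "\<not> n dvd p" using neg unfolding M_def by blast
  obtain q where q: "q \<in> M" "n dvd q" using above[OF n(1)] by blast
  have pq: "p \<noteq> q" using n q by blast
  have proper: "fixpoints u i \<noteq> X" if uv: "u \<in> M" "v \<in> M" "u \<noteq> v" for u v
  proof
    assume "fixpoints u i = X"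
    have "v \<in> set l" using uv(2) unfolding M_def by blast
    then obtain x where "x \<in> X" "len i x = v" using ex_len[OF i] by blast
    with \<open>fixpoints u i = X\<close> have "v dvd u" using fixpoints_iff[OF i, of x u] by simp
    then show False using M_antichain[of "{u, v}"] uv unfolding dvd_antichain_def by blast
  qed
  have "fixpoints p i \<union> fixpoints q i \<noteq> X"
    using not_union_of_two_subquandles[of "fixpoints p i" "fixpoints q i"] fixpoints_closed[OF i]
      proper p q(1) pq by metis
  then obtain x where x: "x \<in> X" "x \<notin> fixpoints p i" "x \<notin> fixpoints q i"
    using fixpoints_subset by blast
  obtain r where r: "r \<in> M" "len i x dvd r" using above[OF len_in[OF i x(1)]] by blast
  have qr: "p \<noteq> r" "q \<noteq> r" using x r fixpoints_iff[OF i] by auto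
  have in_l: "p \<in> set l" "q \<in> set l" "r \<in> set l" using p q r unfolding M_def by auto
  have anti: "dvd_antichain {p, q, r}" "distinct [p, q, r]"
    using M_antichain p q(1) r(1) pq qr by auto
  have neq1: "p \<noteq> 1" "q \<noteq> 1" "r \<noteq> 1" using dvd_antichain_three[OF anti] by auto
  have "{#1, p, q, r#} \<subseteq># mset l"
    using one in_l pq qr neq1 by (auto simp: subseteq_mset_def Suc_le_eq)
  then obtain K where K: "mset l = {#1, p, q, r#} + K" by (auto simp: subset_mset.le_iff_add)
  have "size K \<le> 1" using len5 arg_cong[OF K, of size] by simp
  then consider "K = {#}" | e where "K = {#e#}"
    using size_1_singleton_mset[of K] by (cases "size K") auto
  then show False
  proof cases
    case 1
    then show False using K profile_neq_one_and_antichain[OF i anti] by simp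
  next
    case (2 e)
    have l: "mset l = {#1, p, q, r, e#}" using K 2 by simp
    have set_l: "set l = {1, p, q, r, e}" using arg_cong[OF l, of set_mset] by simp
    have "e \<noteq> 1" using profile_neq_two_ones_and_antichain[OF i anti] l by auto
    moreover have "e \<noteq> 0" using zero unfolding set_l by auto
    ultimately have "2 \<le> e" by simp
    then have not_dvd: "\<not> e dvd p" "\<not> e dvd q" "\<not> e dvd r"
      using profile_neq_antichain_and_divisor[OF i anti _ _] l by blast+
    obtain m where m: "m \<in> M" "e dvd m" using above[of e] unfolding set_l by auto
    have "m \<in> set l" using m(1) unfolding M_def by blast
    then have "m = e" using m(2) not_dvd \<open>e \<noteq> 1\<close> unfolding set_l by auto
    then have "dvd_antichain {p, q, r, e}" using M_antichain m(1) p q(1) r(1) by simp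
    moreover have "distinct [p, q, r, e]" using anti(2) not_dvd by auto
    ultimately show False using profile_neq_one_and_four_antichain[OF i] l by blast
  qed
qed

end

section \<open>The largest cycle length\<close>

theorem theorem1p3:
  fixes X :: "'a set" and qop :: "'a \<Rightarrow> 'a \<Rightarrow> 'a" and c :: nat and l :: "nat list"
  assumes "c \<in> {3, 4, 5}"
    and "finite X"
    and "connected_quandle X qop"
    and "is_profile X qop l"
    and "length l = c"
  shows "\<forall>i\<in>{1..c}. l ! (i - 1) dvd l ! (c - 1)"
proof -
  interpret Q: connected_quandle X qop by fact
  have l: "l = cycle_lengths X (right_translation X qop i)" if "i \<in> X" for i
    using Q.is_profile_iff[OF assms(2)] assms(4) that by blast
  interpret profiled_quandle X qop l
    by unfold_locales (use assms(2) l in auto)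
  obtain x where x: "x \<in> X" using Q.is_profile_iff[OF assms(2)] assms(4) by blast
  obtain m where m: "m \<in> set l" "\<And>n. n \<in> set l \<Longrightarrow> n dvd m"
    using ex_common_multiple[OF x] assms(1,5) by auto
  have c: "c - 1 < length l" using assms(1,5) by auto
  have sorted: "sorted l" unfolding l[OF x] cycle_lengths_def by simp
  obtain j where j: "j < length l" "l ! j = m" using m(1) by (auto simp: in_set_conv_nth)
  \<comment> \<open>A positive common multiple in the list is its maximum, and the list is sorted.\<close>
  have "m \<le> l ! (c - 1)" using sorted_nth_mono[OF sorted, of j "c - 1"] j c assms(5) by simp
  moreover have "0 < m" using ex_len[OF x m(1)] len_pos[OF x] by auto
  then have "l ! (c - 1) \<le> m" using m(2) c by (intro dvd_imp_le) auto
  ultimately have "l ! (c - 1) = m" by simp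
  then show ?thesis using m(2) assms(5) by auto
qed

end
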